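(* For every $n \in \mathbb{N}$, it holds that $$S\left(2\mathbb{N}-1,4n\right)\equiv 0 \pmod{4}.$$
   Context: $\mathbb{N}=\{1,2,3,\dots\}$ and $2\mathbb{N}-1=\{1,3,5,\dots\}$ is the set of odd natural numbers. A partition $\lambda=(\lambda_1,\dots,\lambda_s)$ of $n\in\mathbb{N}$ is a non-increasing sequence of natural numbers with $\sum_{j=1}^s\lambda_j=n$; the $\lambda_j$ are its parts. For a subset $D\subset\mathbb{N}$, $S(D,n)\in\mathbb{Z}$ denotes the sum of all odd parts minus the sum of all even parts, taken over all partitions of $n$ in which parts from $D$ do not repeat (each element of $D$ occurs at most once as a part, while parts not in $D$ may repeat arbitrarily); parts are counted with multiplicity. Thus $S(2\mathbb{N}-1,n)$ concerns partitions of $n$ whose odd parts are distinct and whose even parts are unrestricted. *)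

theory Defs
  imports "HOL-Number_Theory.Cong"
begin

definition partitions :: "nat \<Rightarrow> nat list set" where
  "partitions n = {xs. sorted_wrt (\<ge>) xs \<and> (\<forall>x\<in>set xs. x > 0) \<and> sum_list xs = n}"

text \<open>Partitions of \<open>n\<close> in which every element of \<open>D\<close> occurs at most once as a part.\<close>

definition partitions_norep :: "nat set \<Rightarrow> nat \<Rightarrow> nat list set" where
  "partitions_norep D n = {xs \<in> partitions n. \<forall>d\<in>D. count_list xs d \<le> 1}"

definition parity_sum :: "nat set \<Rightarrow> nat \<Rightarrow> int" where
  "parity_sum D n = (\<Sum>xs\<in>partitions_norep D n.
     int (sum_list (filter odd xs)) - int (sum_list (filter even xs)))"

text \<open>The index set is finite, so the sum above is a genuine one.\<close>

lemma finite_partitions: "finite (partitions n)"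
proof (rule finite_subset)
  have len: "length xs \<le> sum_list xs" if "\<forall>x\<in>set xs. x > 0" for xs :: "nat list"
    using that by (induction xs) auto
  show "partitions n \<subseteq> {xs. set xs \<subseteq> {..n} \<and> length xs \<le> n}"
    using len by (auto simp: partitions_def intro: member_le_sum_list)
  show "finite {xs. set xs \<subseteq> {..n} \<and> length xs \<le> n}"
    by (rule finite_lists_length_le) simp
qed

lemma finite_partitions_norep: "finite (partitions_norep D n)"
  by (rule finite_subset[OF _ finite_partitions[of n]]) (auto simp: partitions_norep_def)

end

theory Submission
  imports Defs
begin

text \<open>
  The congruence holds partition by partition. If \<open>O\<close> and \<open>E\<close> are the sums of the odd and of the
  even parts of a partition of \<open>4n\<close>, then \<open>O + E = 4n\<close>, so \<open>O - E = 4n - 2E\<close>. As a sum of even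
  numbers, \<open>E\<close> is even, hence \<open>4\<close> divides \<open>2E\<close> and with it the contribution \<open>O - E\<close>.
\<close>

lemma even_sum_list_filter_even: "even (sum_list (filter even xs))" for xs :: "nat list"
  by (induction xs) auto

lemma sum_list_filter_odd_plus_even:
  "sum_list (filter odd xs) + sum_list (filter even xs) = sum_list xs" for xs :: "nat list"
  by (induction xs) auto

lemma four_dvd_odd_minus_even:
  fixes xs :: "nat list"
  assumes "4 dvd sum_list xs"
  shows "4 dvd int (sum_list (filter odd xs)) - int (sum_list (filter even xs))"
  using assms even_sum_list_filter_even[of xs] sum_list_filter_odd_plus_even[of xs]
  by presburger

theorem theorem1p5:
  fixes n :: nat
  assumes "n \<ge> 1"
  shows "[parity_sum {k. odd k} (4 * n) = 0] (mod 4)"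
proof -
  have "4 dvd parity_sum {k. odd k} (4 * n)"
    unfolding parity_sum_def
  proof (rule dvd_sum)
    fix xs assume "xs \<in> partitions_norep {k. odd k} (4 * n)"
    then have "sum_list xs = 4 * n"
      by (simp add: partitions_norep_def partitions_def)
    then show "4 dvd int (sum_list (filter odd xs)) - int (sum_list (filter even xs))"
      by (intro four_dvd_odd_minus_even) simp
  qed
  then show ?thesis
    by (simp add: cong_0_iff)
qed

end
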